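(* Let $A$ be a left-symmetric conformal algebra and let $\omega_\lambda:A\times A\to A^{*c}[\lambda]$ be a $\mathbb{C}$-bilinear map. Define a $\lambda$-product on the $\mathbb{C}[\partial]$-module $A\oplus A^{*c}$ by $$(a+f)\cdot^\omega_\lambda(b+g)=a_\lambda b+\omega_\lambda(a,b)+L^*_A(a)_\lambda g,\qquad a,b\in A,\ f,g\in A^{*c}.$$ Then $(A\oplus A^{*c},\cdot^\omega)$ is a left-symmetric conformal algebra if and only if $\omega$ is a $2$-cocycle of $A$ with coefficients in the module $A^{*c}_L=(A^{*c},L^*_A,0)$.
   Context: $A$ is finitely generated as a $\mathbb{C}[\partial]$-module. Products and actions are extended coefficientwise to polynomials in $\lambda,\mu$. A left-symmetric conformal algebra is a $\mathbb{C}[\partial]$-module $A$ with a $\mathbb{C}$-linear map $A\otimes A\to A[\lambda]$, $a\otimes b\mapsto a_\lambda b$, such that $(\partial a)_\lambda b=-\lambda a_\lambda b$, $a_\lambda(\partial b)=(\partial+\lambda)a_\lambda b$ and $(a_\lambda b)_{\lambda+\mu}c-a_\lambda(b_\mu c)=(b_\mu a)_{\lambda+\mu}c-b_\mu(a_\lambda c)$. The conformal dual $A^{*c}$ is the space of $\mathbb{C}$-linear maps $f_\lambda:A\to\mathbb{C}[\lambda]$ with $f_\lambda(\partial a)=\lambda f_\lambda(a)$ (conformal linear maps to the trivial $\mathbb{C}[\partial]$-module $\mathbb{C}$), a $\mathbb{C}[\partial]$-module via $(\partial f)_\lambda=-\lambda f_\lambda$. Define $L^*_A(a)_\lambda f\in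 A^{*c}[\lambda]$ by $\big(L^*_A(a)_\lambda f\big)_{\lambda+\mu}b=-f_\mu(a_\lambda b)$. The $A$-module $A^{*c}_L=(A^{*c},L^*_A,0)$ is $A^{*c}$ with left action $a_\lambda f=L^*_A(a)_\lambda f$ and zero right action. A $2$-cochain with coefficients in $A^{*c}_L$ is a $\mathbb{C}$-bilinear map $\omega_\lambda:A\times A\to A^{*c}[\lambda]$ with $\omega_\lambda(\partial a,b)=-\lambda\omega_\lambda(a,b)$ and $\omega_\lambda(a,\partial b)=(\partial+\lambda)\omega_\lambda(a,b)$. It is a $2$-cocycle with coefficients in $A^{*c}_L$ if, for all $a,b,c\in A$, $$L^*_A(a)_\lambda\omega_\mu(b,c)-L^*_A(b)_\mu\omega_\lambda(a,c)-\omega_\mu(b,a_\lambda c)+\omega_\lambda(a,b_\mu c)-\omega_{\lambda+\mu}(a_\lambda b,c)+\omega_{\lambda+\mu}(b_\mu a,c)=0.$$ *)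

theory Defs
  imports
    Complex_Main
    "HOL-Library.Product_Plus"
    "HOL-Computational_Algebra.Polynomial"
begin

section \<open>Modules over the polynomial ring in one derivation\<close>

text \<open>The axioms are those of the locale \<^locale>\<open>module\<close> over the ring \<^typ>\<open>complex poly\<close>,
  whose indeterminate plays the role of the derivation.\<close>

class cd_module = ab_group_add +
  fixes act :: "complex poly \<Rightarrow> 'a \<Rightarrow> 'a"
  assumes act_add_right: "act p (x + y) = act p x + act p y"
    and act_add_left: "act (p + q) x = act p x + act q x"
    and act_act: "act p (act q x) = act (p * q) x"
    and act_one: "act 1 x = x"

interpretation cd_module: module "act :: complex poly \<Rightarrow> 'a::cd_module \<Rightarrow> 'a"
  by unfold_locales (fact act_add_right act_add_left act_act act_one)+

definition cscale :: "complex \<Rightarrow> 'a::cd_module \<Rightarrow> 'a"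
  where "cscale c = act [:c:]"

definition del :: "'a::cd_module \<Rightarrow> 'a"
  where "del = act [:0, 1:]"

interpretation cd_vs: vector_space "cscale :: complex \<Rightarrow> 'a::cd_module \<Rightarrow> 'a"
  by unfold_locales
    (simp_all add: cscale_def act_add_right act_act act_one one_pCons[symmetric] mult.commute
      flip: act_add_left)

text \<open>If \<open>A\<close> is a module, \<^typ>\<open>'a poly\<close> is \<open>A[\<lambda>]\<close>, on which the ring acts coefficientwise.\<close>

instantiation poly :: (cd_module) cd_module
begin

definition act_poly :: "complex poly \<Rightarrow> 'a poly \<Rightarrow> 'a poly"
  where "act_poly p = map_poly (act p)"

instance
  by standard
    (simp_all add: act_poly_def poly_eq_iff coeff_map_poly act_add_right act_add_left act_act act_one)

end

instantiation prod :: (cd_module, cd_module) cd_module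
begin

definition act_prod :: "complex poly \<Rightarrow> 'a \<times> 'b \<Rightarrow> 'a \<times> 'b"
  where "act_prod p = map_prod (act p) (act p)"

instance
  by standard
    (auto simp: act_prod_def act_add_right act_add_left act_act act_one)

end


section \<open>Polynomials in two indeterminates\<close>

text \<open>\<open>M[\<lambda>, \<mu>]\<close> is rendered as \<^typ>\<open>'m poly poly\<close>, the outer indeterminate being \<open>\<lambda>\<close> and the
  inner one \<open>\<mu>\<close>. The following maps are multiplication by \<open>\<lambda>\<close>, by \<open>\<mu>\<close> and by \<open>\<lambda> + \<mu>\<close>.\<close>

definition mul_lam :: "'m::ab_group_add poly poly \<Rightarrow> 'm poly poly"
  where "mul_lam = pCons 0"

definition mul_mu :: "'m::ab_group_add poly poly \<Rightarrow> 'm poly poly"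
  where "mul_mu = map_poly (pCons 0)"

definition mul_sum :: "'m::ab_group_add poly poly \<Rightarrow> 'm poly poly"
  where "mul_sum q = mul_lam q + mul_mu q"

text \<open>Coefficientwise extension: \<open>ext X \<phi> (\<Sum>\<^sub>i x\<^sub>i t\<^sup>i) = \<Sum>\<^sub>i X\<^sup>i (\<phi> x\<^sub>i)\<close>, where \<open>X\<close> is the
  multiplication by the polynomial substituted for the indeterminate \<open>t\<close>.
  With \<open>\<phi>\<close> the inclusion of constants this is mere substitution. For instance
  \<open>(a\<^sub>\<lambda> b)\<^sub>\<lambda>\<^sub>+\<^sub>\<mu> c\<close> becomes \<open>ext mul_lam (\<lambda>x. at_var mul_sum (pr x c)) (pr a b)\<close>.\<close>

definition ext :: "('m \<Rightarrow> 'm) \<Rightarrow> ('a::zero \<Rightarrow> 'm) \<Rightarrow> 'a poly \<Rightarrow> 'm::comm_monoid_add"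
  where "ext X \<phi> p = (\<Sum>i\<le>degree p. (X ^^ i) (\<phi> (coeff p i)))"

definition at_var :: "('m poly poly \<Rightarrow> 'm poly poly) \<Rightarrow> 'm poly \<Rightarrow> 'm::ab_group_add poly poly"
  where "at_var X = ext X (\<lambda>x. [:[:x:]:])"


section \<open>Left-symmetric conformal algebras\<close>

definition complex_bilinear :: "('a::cd_module \<Rightarrow> 'b::cd_module \<Rightarrow> 'c::cd_module) \<Rightarrow> bool"
  where "complex_bilinear h \<longleftrightarrow>
    (\<forall>x. Vector_Spaces.linear cscale cscale (h x)) \<and>
    (\<forall>y. Vector_Spaces.linear cscale cscale (\<lambda>x. h x y))"

text \<open>\<^term>\<open>pCons 0\<close> is multiplication by \<open>\<lambda>\<close> on \<open>M[\<lambda>]\<close>.\<close>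

definition conformal_sesquilinear ::
    "('a::cd_module \<Rightarrow> 'b::cd_module \<Rightarrow> 'c::cd_module poly) \<Rightarrow> bool"
  where "conformal_sesquilinear h \<longleftrightarrow>
    (\<forall>a b. h (del a) b = - pCons 0 (h a b)) \<and>
    (\<forall>a b. h a (del b) = del (h a b) + pCons 0 (h a b))"

definition left_symmetric_conformal_algebra :: "('a::cd_module \<Rightarrow> 'a \<Rightarrow> 'a poly) \<Rightarrow> bool"
  where "left_symmetric_conformal_algebra pr \<longleftrightarrow>
    complex_bilinear pr \<and> conformal_sesquilinear pr \<and>
    (\<forall>a b c.
      ext mul_lam (\<lambda>x. at_var mul_sum (pr x c)) (pr a b)
        - ext mul_mu (\<lambda>x. at_var mul_lam (pr a x)) (pr b c)
      = ext mul_mu (\<lambda>x. at_var mul_sum (pr x c)) (pr b a)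
        - ext mul_lam (\<lambda>x. at_var mul_mu (pr b x)) (pr a c))"


section \<open>The conformal dual\<close>

typedef (overloaded) 'a conformal_dual =
  "{f :: 'a::cd_module \<Rightarrow> complex poly.
      Vector_Spaces.linear cscale smult f \<and> (\<forall>a. f (del a) = pCons 0 (f a))}"
  morphisms app Abs_conformal_dual
proof -
  have "Vector_Spaces.linear cscale smult (\<lambda>x::'a. 0 :: complex poly)"
    by unfold_locales (simp_all add: smult_add_right smult_add_left)
  then show ?thesis
    by (intro exI[of _ "\<lambda>x. 0"]) simp
qed

setup_lifting type_definition_conformal_dual

lemma linear_smult_iff:
  "Vector_Spaces.linear cscale smult (f :: 'a::cd_module \<Rightarrow> complex poly) \<longleftrightarrow>
    (\<forall>x y. f (x + y) = f x + f y) \<and> (\<forall>c x. f (cscale c x) = smult c (f x))"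
  (is "?l \<longleftrightarrow> ?r")
proof
  assume ?l
  then interpret Vector_Spaces.linear cscale smult f .
  show ?r by (simp add: add scale)
next
  assume ?r
  then show ?l
    by unfold_locales (simp_all add: smult_add_right smult_add_left)
qed

text \<open>The action sends \<open>(p, f)\<close> to \<open>p(-\<lambda>) f\<^sub>\<lambda>\<close>, so that the derivation acts as \<open>-\<lambda>\<close>.\<close>

instantiation conformal_dual :: (cd_module) cd_module
begin

lift_definition zero_conformal_dual :: "'a conformal_dual" is "\<lambda>_. 0"
  by (simp add: linear_smult_iff)

lift_definition plus_conformal_dual :: "'a conformal_dual \<Rightarrow> 'a conformal_dual \<Rightarrow> 'a conformal_dual"
  is "\<lambda>f g a. f a + g a"
  by (auto simp: linear_smult_iff smult_add_right)

lift_definition uminus_conformal_dual :: "'a conformal_dual \<Rightarrow> 'a conformal_dual"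
  is "\<lambda>f a. - f a"
  by (auto simp: linear_smult_iff)

lift_definition minus_conformal_dual :: "'a conformal_dual \<Rightarrow> 'a conformal_dual \<Rightarrow> 'a conformal_dual"
  is "\<lambda>f g a. f a - g a"
  by (auto simp: linear_smult_iff smult_diff_right)

lift_definition act_conformal_dual :: "complex poly \<Rightarrow> 'a conformal_dual \<Rightarrow> 'a conformal_dual"
  is "\<lambda>p f a. pcompose p [:0, -1:] * f a"
  by (auto simp: linear_smult_iff algebra_simps)

instance
  by standard (transfer; simp add: fun_eq_iff algebra_simps pcompose_add pcompose_mult pcompose_1)+

end

text \<open>\<open>dual_left pr a f\<close> is \<open>L\<^sup>*(a)\<^sub>\<lambda> f\<close>, the polynomial \<open>F\<close> with conformal functionals as
  coefficients such that \<open>F\<^sub>\<lambda>\<^sub>+\<^sub>\<mu>(b) = -f\<^sub>\<mu>(a\<^sub>\<lambda> b)\<close> in \<open>\<complex>[\<lambda>, \<mu>]\<close>. The finite generation of the module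
  is what bounds the degree of \<open>F\<close>; see \<open>dual_left_ex1\<close> below.\<close>

definition is_dual_left ::
    "('a::cd_module \<Rightarrow> 'a \<Rightarrow> 'a poly) \<Rightarrow> 'a \<Rightarrow> 'a conformal_dual \<Rightarrow> 'a conformal_dual poly \<Rightarrow> bool"
  where "is_dual_left pr a f F \<longleftrightarrow>
    (\<forall>b. ext mul_lam (\<lambda>\<phi>. at_var mul_sum (app \<phi> b)) F
       = - ext mul_lam (\<lambda>x. at_var mul_mu (app f x)) (pr a b))"

definition dual_left ::
    "('a::cd_module \<Rightarrow> 'a \<Rightarrow> 'a poly) \<Rightarrow> 'a \<Rightarrow> 'a conformal_dual \<Rightarrow> 'a conformal_dual poly"
  where "dual_left pr a f = (THE F. is_dual_left pr a f F)"


section \<open>Cocycles and the product on the direct sum\<close>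

definition two_cochain :: "('a::cd_module \<Rightarrow> 'a \<Rightarrow> 'a conformal_dual poly) \<Rightarrow> bool"
  where "two_cochain \<omega> \<longleftrightarrow> complex_bilinear \<omega> \<and> conformal_sesquilinear \<omega>"

definition two_cocycle ::
    "('a::cd_module \<Rightarrow> 'a \<Rightarrow> 'a poly) \<Rightarrow> ('a \<Rightarrow> 'a \<Rightarrow> 'a conformal_dual poly) \<Rightarrow> bool"
  where "two_cocycle pr \<omega> \<longleftrightarrow> two_cochain \<omega> \<and>
    (\<forall>a b c.
      ext mul_mu (\<lambda>f. at_var mul_lam (dual_left pr a f)) (\<omega> b c)
      - ext mul_lam (\<lambda>f. at_var mul_mu (dual_left pr b f)) (\<omega> a c)
      - ext mul_lam (\<lambda>x. at_var mul_mu (\<omega> b x)) (pr a c)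
      + ext mul_mu (\<lambda>x. at_var mul_lam (\<omega> a x)) (pr b c)
      - ext mul_lam (\<lambda>x. at_var mul_sum (\<omega> x c)) (pr a b)
      + ext mul_mu (\<lambda>x. at_var mul_sum (\<omega> x c)) (pr b a) = 0)"

definition twisted_product ::
    "('a::cd_module \<Rightarrow> 'a \<Rightarrow> 'a poly) \<Rightarrow> ('a \<Rightarrow> 'a \<Rightarrow> 'a conformal_dual poly) \<Rightarrow>
      'a \<times> 'a conformal_dual \<Rightarrow> 'a \<times> 'a conformal_dual \<Rightarrow> ('a \<times> 'a conformal_dual) poly"
  where "twisted_product pr \<omega> = (\<lambda>(a, f) (b, g).
    map_poly (\<lambda>x. (x, 0)) (pr a b) + map_poly (\<lambda>h. (0, h)) (\<omega> a b + dual_left pr a g))"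

section \<open>Well-definedness of the dual action\<close>

text \<open>For scalar coefficients everything is expressed in the ring \<open>\<complex>[\<mu>][\<lambda>]\<close>; identities there are
  checked by evaluation at pairs of complex numbers.\<close>

definition ev2 :: "complex \<Rightarrow> complex \<Rightarrow> complex poly poly \<Rightarrow> complex"
  where "ev2 l m P = poly (poly P [:l:]) m"

lemma ev2_simps:
  "ev2 l m (P + Q) = ev2 l m P + ev2 l m Q"
  "ev2 l m (P * Q) = ev2 l m P * ev2 l m Q"
  "ev2 l m (P ^ n) = ev2 l m P ^ n"
  "ev2 l m 0 = 0"
  "ev2 l m [:p:] = poly p m"
  "ev2 l m (pCons p P) = poly p m + l * ev2 l m P"
  by (simp_all add: ev2_def)

lemma ev2_sum: "ev2 l m (\<Sum>i\<in>A. f i) = (\<Sum>i\<in>A. ev2 l m (f i))"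
  by (simp add: ev2_def poly_sum)

lemma ev2_altdef: "ev2 l m P = (\<Sum>i\<le>degree P. l ^ i * poly (coeff P i) m)"
  unfolding ev2_def
  by (subst poly_altdef[of P]) (simp add: poly_sum mult.commute)

lemma ev2_eqI:
  assumes "\<And>l m. ev2 l m P = ev2 l m Q"
  shows "P = Q"
proof -
  have *: "poly (P - Q) [:l:] = 0" for l
    using assms[of l] by (simp add: ev2_def poly_eq_poly_eq_iff[symmetric] fun_eq_iff)
  have "infinite (range (\<lambda>l::complex. [:l:]))"
    by (meson finite_imageD infinite_UNIV_char_0 injI pCons_eq_iff)
  then have "infinite {x. poly (P - Q) x = 0}"
    using * by (metis (mono_tags, lifting) finite_subset image_subsetI mem_Collect_eq)
  then show ?thesis
    using poly_roots_finite[of "P - Q"] by auto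
qed

lemma funpow_mul_lam: "(mul_lam ^^ i) P = [:0, 1:] ^ i * (P :: complex poly poly)"
  by (induction i) (simp_all add: mul_lam_def algebra_simps)

lemma mul_mu_eq: "mul_mu P = [:[:0, 1:]:] * (P :: complex poly poly)"
  unfolding mul_mu_def by (rule poly_eqI) (simp add: coeff_map_poly)

lemma funpow_mul_mu: "(mul_mu ^^ i) P = [:[:0, 1:]:] ^ i * (P :: complex poly poly)"
  by (induction i) (simp_all add: mul_mu_eq algebra_simps del: mult_pCons_left mult_pCons_right)

lemma funpow_mul_sum: "(mul_sum ^^ i) P = [:[:0, 1:], 1:] ^ i * (P :: complex poly poly)"
proof (induction i)
  case (Suc i)
  then show ?case
    by (simp only: funpow.simps o_apply mul_sum_def mul_lam_def mul_mu_eq)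
       (simp add: algebra_simps)
qed simp

lemma poly_eq_sum: "poly (p :: complex poly) x = (\<Sum>i\<le>degree p. x ^ i * coeff p i)"
  by (simp add: poly_altdef mult.commute)

lemma ev2_at_sum: "ev2 l m (at_var mul_sum (p :: complex poly)) = poly p (l + m)"
  by (simp add: at_var_def ext_def funpow_mul_sum ev2_sum ev2_simps poly_eq_sum add.commute
      del: mult_pCons_left mult_pCons_right)

lemma ev2_at_mu: "ev2 l m (at_var mul_mu (p :: complex poly)) = poly p m"
  by (simp add: at_var_def ext_def funpow_mul_mu ev2_sum ev2_simps poly_eq_sum
      del: mult_pCons_left mult_pCons_right)

lemma ev2_ext_lam:
  "ev2 l m (ext mul_lam \<phi> p) = (\<Sum>i\<le>degree p. l ^ i * ev2 l m (\<phi> (coeff p i)))"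
  by (simp add: ext_def funpow_mul_lam ev2_sum ev2_simps del: mult_pCons_left mult_pCons_right)

lemma sum_degree_pad:
  assumes "degree p \<le> n" "h 0 = (0::complex)"
  shows "(\<Sum>i\<le>degree p. l ^ i * h (coeff p i)) = (\<Sum>i\<le>n. l ^ i * h (coeff p i))"
  by (rule sum.mono_neutral_left) (use assms in \<open>auto simp: coeff_eq_0\<close>)

text \<open>The substitution \<open>\<mu> \<mapsto> \<mu> - \<lambda>\<close>.\<close>

definition shift :: "complex poly poly \<Rightarrow> complex poly poly"
  where "shift P = (\<Sum>i\<le>degree P. [:0, 1:] ^ i * poly (map_poly (\<lambda>c. [:[:c:]:]) (coeff P i)) [:[:0, 1:], -1:])"

lemma ev2_lift: "ev2 l m (poly (map_poly (\<lambda>c. [:[:c:]:]) p) T) = poly p (ev2 l m T)"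
  by (induction p) (simp_all add: ev2_simps map_poly_pCons del: mult_pCons_left mult_pCons_right)

lemma ev2_shift: "ev2 l m (shift P) = ev2 l (m - l) P"
proof -
  have "ev2 l (m - l) P = (\<Sum>i\<le>degree P. l ^ i * poly (coeff P i) (m - l))"
    by (rule ev2_altdef)
  then show ?thesis
    by (simp add: shift_def ev2_sum ev2_simps ev2_lift del: mult_pCons_left mult_pCons_right)
qed

lemma app_linear:
  "app f (x + y) = app f x + app f y"
  "app f (cscale c x) = smult c (app f x)"
  "app f (del x) = pCons 0 (app f x)"
  using app[of f] by (auto simp: linear_smult_iff)

lemma app_0: "app f 0 = 0"
  using app_linear(1)[of f 0 0] by simp

lemma ev2_ext_app:
  "ev2 l m (ext mul_lam (\<lambda>x. at_var mul_mu (app f x)) p) = ev2 l m (map_poly (app f) p)"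
proof -
  have "ev2 l m (map_poly (app f) p) = (\<Sum>i\<le>degree (map_poly (app f) p). l ^ i * poly (app f (coeff p i)) m)"
    by (simp add: ev2_altdef coeff_map_poly app_0)
  also have "\<dots> = (\<Sum>i\<le>degree p. l ^ i * poly (app f (coeff p i)) m)"
  proof (rule sum.mono_neutral_left)
    show "\<forall>i\<in>{..degree p} - {..degree (map_poly (app f) p)}. l ^ i * poly (app f (coeff p i)) m = 0"
    proof
      fix i assume "i \<in> {..degree p} - {..degree (map_poly (app f) p)}"
      then have "coeff (map_poly (app f) p) i = 0"
        by (simp add: coeff_eq_0)
      then show "l ^ i * poly (app f (coeff p i)) m = 0"
        by (simp add: coeff_map_poly app_0)
    qed
  qed (auto simp: map_poly_degree_leq)
  finally show ?thesis
    by (simp add: ev2_ext_lam ev2_at_mu)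
qed

lemma is_dual_left_iff:
  "is_dual_left pr a f F \<longleftrightarrow>
    (\<forall>b. map_poly (\<lambda>\<phi>. app \<phi> b) F = - shift (map_poly (app f) (pr a b)))"
proof -
  have z: "app (0 :: 'a conformal_dual) b = 0" for b
    by transfer simp
  have L: "ev2 l m (ext mul_lam (\<lambda>\<phi>. at_var mul_sum (app \<phi> b)) F)
      = ev2 l (m + l) (map_poly (\<lambda>\<phi>. app \<phi> b) F)" for l m b
  proof -
    let ?P = "map_poly (\<lambda>\<phi>. app \<phi> b) F"
    have "ev2 l (m + l) ?P = (\<Sum>i\<le>degree ?P. l ^ i * poly (coeff ?P i) (m + l))"
      by (rule ev2_altdef)
    also have "\<dots> = (\<Sum>i\<le>degree F. l ^ i * poly (coeff ?P i) (m + l))"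
      by (rule sum_degree_pad) (simp_all add: map_poly_degree_leq)
    also have "\<dots> = ev2 l m (ext mul_lam (\<lambda>\<phi>. at_var mul_sum (app \<phi> b)) F)"
      by (simp add: ev2_ext_lam ev2_at_sum coeff_map_poly z add.commute)
    finally show ?thesis by simp
  qed
  have neg: "ev2 l m (- P) = - ev2 l m P" for l m P
    by (simp add: ev2_def)
  show ?thesis
    unfolding is_dual_left_def
  proof (intro all_cong1 iffI)
    fix b
    let ?P = "map_poly (\<lambda>\<phi>. app \<phi> b) F" and ?Q = "map_poly (app f) (pr a b)"
    let ?L = "ext mul_lam (\<lambda>\<phi>. at_var mul_sum (app \<phi> b)) F"
      and ?R = "- ext mul_lam (\<lambda>x. at_var mul_mu (app f x)) (pr a b)"
    {
      assume eq: "?L = ?R"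
      show "?P = - shift ?Q"
      proof (rule ev2_eqI)
        fix l m
        have "ev2 l (m - l) ?L = ev2 l (m - l) ?R"
          using eq by simp
        then show "ev2 l m ?P = ev2 l m (- shift ?Q)"
          by (simp add: L neg ev2_ext_app ev2_shift)
      qed
    next
      assume "?P = - shift ?Q"
      then show "?L = ?R"
        by (intro ev2_eqI) (simp add: L neg ev2_ext_app ev2_shift)
    }
  qed
qed

lemma dual_left_ex1:
  fixes pr :: "'a::cd_module \<Rightarrow> 'a \<Rightarrow> 'a poly"
  assumes fg: "\<exists>S::'a set. finite S \<and> module.span act S = UNIV"
    and bil: "complex_bilinear pr" and ses: "conformal_sesquilinear pr"
  shows "\<exists>!F. is_dual_left pr a f F"
proof -
  define R where "R b = - shift (map_poly (app f) (pr a b))" for b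
  interpret h: Vector_Spaces.linear cscale cscale "pr a"
    using bil by (simp add: complex_bilinear_def)
  have R_ev: "ev2 l m (R b) = - ev2 l (m - l) (map_poly (app f) (pr a b))" for l m b
    by (simp add: R_def ev2_shift ev2_def flip: ev2_shift[unfolded ev2_def])
  have R_add: "R (x + y) = R x + R y" for x y
  proof -
    have "map_poly (app f) (pr a (x + y)) = map_poly (app f) (pr a x) + map_poly (app f) (pr a y)"
      by (rule poly_eqI) (simp add: h.add coeff_map_poly app_0 app_linear)
    then show ?thesis
      by (intro ev2_eqI) (simp add: R_ev ev2_simps)
  qed
  have R_scale: "R (cscale c x) = smult [:c:] (R x)" for c x
  proof -
    have "coeff (pr a (cscale c x)) n = cscale c (coeff (pr a x) n)" for n
      using h.scale[of c x] by (simp add: cscale_def act_poly_def coeff_map_poly)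
    then have "map_poly (app f) (pr a (cscale c x)) = [:[:c:]:] * map_poly (app f) (pr a x)"
      by (intro poly_eqI) (simp add: coeff_map_poly app_0 app_linear)
    moreover have "smult [:c:] (R x) = [:[:c:]:] * R x" by simp
    ultimately show ?thesis
      by (intro ev2_eqI) (simp add: R_ev ev2_simps del: mult_pCons_left mult_pCons_right)
  qed
  have R_del: "R (del x) = smult [:0, 1:] (R x)" for x
  proof -
    have "map_poly (app f) (pr a (del x)) = [:[:0, 1:], 1:] * map_poly (app f) (pr a x)"
    proof -
      have "pr a (del x) = map_poly del (pr a x) + pCons 0 (pr a x)"
        using ses by (simp add: conformal_sesquilinear_def del_def act_poly_def)
      moreover have "map_poly (app f) (map_poly del p + pCons 0 p)
          = [:[:0, 1:], 1:] * map_poly (app f) p" for p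
      proof (rule poly_eqI)
        fix n
        have d0: "del (0::'a) = 0" by (simp add: del_def)
        show "coeff (map_poly (app f) (map_poly del p + pCons 0 p)) n
          = coeff ([:[:0, 1:], 1:] * map_poly (app f) p) n"
          by (cases n) (simp_all add: coeff_map_poly app_0 app_linear d0)
      qed
      ultimately show ?thesis by simp
    qed
    moreover have "smult [:0, 1:] (R x) = [:[:0, 1:]:] * R x" by simp
    ultimately show ?thesis
      by (intro ev2_eqI)
        (simp add: R_ev ev2_simps algebra_simps del: mult_pCons_left mult_pCons_right)
  qed
  have act_pCons: "act (pCons c q) x = cscale c x + del (act q x)" for c q and x :: 'a
    by (simp add: cscale_def del_def act_act flip: act_add_left)
  have R_act: "R (act q x) = smult q (R x)" for q x
  proof (induction q)
    case 0
    have "R 0 = 0" using R_add[of 0 0] by simp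
    then show ?case by simp
  next
    case (pCons c q)
    have "smult (pCons c q) (R x) = smult [:c:] (R x) + smult [:0, 1:] (smult q (R x))"
      by (simp flip: smult_add_left)
    then show ?case
      by (simp only: act_pCons R_add R_scale R_del pCons.IH)
  qed
  obtain S :: "'a set" where S: "finite S" "module.span act S = UNIV"
    using fg by blast
  define N where "N = Max (insert 0 ((\<lambda>s. degree (R s)) ` S))"
  have "cd_module.subspace {b. degree (R b) \<le> N}"
    unfolding cd_module.subspace_def
  proof (intro conjI ballI allI)
    show "0 \<in> {b. degree (R b) \<le> N}"
      using R_add[of 0 0] by simp
  next
    fix x y assume "x \<in> {b. degree (R b) \<le> N}" "y \<in> {b. degree (R b) \<le> N}"
    then show "x + y \<in> {b. degree (R b) \<le> N}"
      by (simp add: R_add degree_add_le)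
  next
    fix q x assume "x \<in> {b. degree (R b) \<le> N}"
    then show "act q x \<in> {b. degree (R b) \<le> N}"
      by (simp add: R_act)
  qed
  moreover have "S \<subseteq> {b. degree (R b) \<le> N}"
    using S(1) by (auto simp: N_def intro!: Max_ge)
  ultimately have deg: "degree (R b) \<le> N" for b
    using cd_module.span_minimal S(2) by blast
  define G where "G i = Abs_conformal_dual (\<lambda>b. coeff (R b) i)" for i
  have G: "app (G i) b = coeff (R b) i" for i b
  proof -
    have "(\<lambda>b. coeff (R b) i) \<in>
        {f. Vector_Spaces.linear cscale smult f \<and> (\<forall>a. f (del a) = pCons 0 (f a))}"
      by (auto simp: linear_smult_iff R_add R_scale R_del)
    then show ?thesis
      by (simp add: G_def Abs_conformal_dual_inverse)
  qed
  have app_z: "app (0 :: 'a conformal_dual) b = 0" for b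
    by transfer simp
  define F where "F = (\<Sum>i\<le>N. monom (G i) i)"
  have cF: "coeff F i = (if i \<le> N then G i else 0)" for i
    by (simp add: F_def coeff_sum sum.delta)
  have "is_dual_left pr a f F"
    unfolding is_dual_left_iff
  proof
    fix b
    have "coeff (map_poly (\<lambda>\<phi>. app \<phi> b) F) i = coeff (R b) i" for i
      using deg[of b] by (auto simp: coeff_map_poly app_z cF G coeff_eq_0)
    then show "map_poly (\<lambda>\<phi>. app \<phi> b) F = - shift (map_poly (app f) (pr a b))"
      unfolding R_def by (rule poly_eqI)
  qed
  moreover have "F' = F''" if "is_dual_left pr a f F'" "is_dual_left pr a f F''" for F' F''
  proof (rule poly_eqI)
    fix i
    have "map_poly (\<lambda>\<phi>. app \<phi> b) F' = map_poly (\<lambda>\<phi>. app \<phi> b) F''" for b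
      using that by (simp add: is_dual_left_iff)
    then have "coeff (map_poly (\<lambda>\<phi>. app \<phi> b) F') i = coeff (map_poly (\<lambda>\<phi>. app \<phi> b) F'') i" for b
      by simp
    then show "coeff F' i = coeff F'' i"
      by (simp add: coeff_map_poly app_z app_inject[symmetric] fun_eq_iff)
  qed
  ultimately show ?thesis by blast
qed

end

theory Submission
  imports Defs
begin

text \<open>The component of \<open>A \<oplus> A\<^sup>*\<^sup>c\<close> in \<open>A\<close> satisfies the left-symmetry axiom because \<open>A\<close> does.
  The component in \<open>A\<^sup>*\<^sup>c\<close> of the axiom for \<open>(a + f, b + g, c + h)\<close> depends only on \<open>a, b, c, h\<close>, and
  splits into the cocycle expression at \<open>(a, b, c)\<close> and the identity
  \<open>L\<^sup>*(a\<^sub>\<lambda> b)\<^sub>\<lambda>\<^sub>+\<^sub>\<mu> h - L\<^sup>*(a)\<^sub>\<lambda> L\<^sup>*(b)\<^sub>\<mu> h = L\<^sup>*(b\<^sub>\<mu> a)\<^sub>\<lambda>\<^sub>+\<^sub>\<mu> h - L\<^sup>*(b)\<^sub>\<mu> L\<^sup>*(a)\<^sub>\<lambda> h\<close>.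
  To see that the latter always holds, evaluate the functionals at \<open>d \<in> A\<close> and the indeterminates
  at complex numbers, which separates points: with \<open>(L\<^sup>*(a)\<^sub>\<lambda> h)\<^sub>\<nu>(d) = -h\<^sub>\<nu>\<^sub>-\<^sub>\<lambda>(a\<^sub>\<lambda> d)\<close> it becomes
  \<open>h\<^sub>\<nu>\<^sub>-\<^sub>\<lambda>\<^sub>-\<^sub>\<mu>\<close> applied to the left-symmetry axiom of \<open>A\<close> for \<open>(a, b, d)\<close>.\<close>

section \<open>Coefficientwise extension\<close>

lemma funpow_additive: "additive X \<Longrightarrow> additive (X ^^ i)"
  for X :: "'a::ab_group_add \<Rightarrow> 'a"
  unfolding additive_def by (induction i) simp_all

lemma funpow_zero: "additive X \<Longrightarrow> (X ^^ i) 0 = 0"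
  for X :: "'a::ab_group_add \<Rightarrow> 'a"
  by (simp add: additive.zero funpow_additive)

text \<open>The degree of a sum or of an image can drop, so sums cut off at the degree do not
  combine directly. Padding to a common bound is harmless: each added term is a power of
  \<open>X\<close> at 0.\<close>

lemma ext_pad:
  assumes "additive X" "\<phi> 0 = 0" "degree p \<le> n"
  shows "ext X \<phi> p = (\<Sum>i\<le>n. (X ^^ i) (\<phi> (coeff p i)))"
  unfolding ext_def
  by (rule sum.mono_neutral_left) (use assms in \<open>auto simp: coeff_eq_0 funpow_zero\<close>)

lemma ext_zero: "additive X \<Longrightarrow> \<phi> 0 = 0 \<Longrightarrow> ext X \<phi> 0 = 0"
  by (simp add: ext_def)

lemma ext_add:
  assumes "additive X" "additive \<phi>"
  shows "ext X \<phi> (p + q) = ext X \<phi> p + ext X \<phi> q"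
proof -
  define n where "n = max (degree p) (degree q)"
  have n: "degree p \<le> n" "degree q \<le> n" "degree (p + q) \<le> n"
    by (auto simp: n_def degree_add_le)
  note pad = ext_pad[where X = X and \<phi> = \<phi> and n = n, OF assms(1) additive.zero[OF assms(2)]]
  show ?thesis
    by (simp add: pad n additive.add[OF assms(2)] additive.add[OF funpow_additive[OF assms(1)]] sum.distrib)
qed

lemma additive_ext: "additive X \<Longrightarrow> additive \<phi> \<Longrightarrow> additive (ext X \<phi>)"
  by (simp add: additive_def ext_add)

lemma ext_add_fun:
  assumes "additive X"
  shows "ext X (\<lambda>x. \<phi> x + \<psi> x) p = ext X \<phi> p + ext X \<psi> p"
  by (simp add: ext_def additive.add[OF funpow_additive[OF assms]] sum.distrib)

lemma ext_map_poly:
  assumes "additive X" "\<phi> 0 = 0" "g 0 = 0"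
  shows "ext X \<phi> (map_poly g p) = ext X (\<lambda>x. \<phi> (g x)) p"
  by (subst ext_pad[where n = "degree p"])
    (simp_all add: ext_def coeff_map_poly map_poly_degree_leq assms)

text \<open>Applied with two kinds of \<open>T\<close>: a map on coefficients, which projects an
  identity to a component, and an evaluation of the indeterminates.\<close>

lemma ext_intertwine:
  assumes "additive T" "\<And>x. T (X x) = Y (T x)"
  shows "T (ext X \<phi> p) = ext Y (\<lambda>x. T (\<phi> x)) p"
proof -
  have "T ((X ^^ i) x) = (Y ^^ i) (T x)" for i x
    by (induction i) (simp_all add: assms(2))
  then show ?thesis
    by (simp add: ext_def additive.sum[OF assms(1)])
qed

text \<open>Horner's scheme; it makes evaluation recursive in the polynomial.\<close>

lemma ext_pCons:
  assumes "additive X" "\<phi> 0 = 0"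
  shows "ext X \<phi> (pCons c p) = \<phi> c + X (ext X \<phi> p)"
proof -
  have "ext X \<phi> (pCons c p) = (\<Sum>i\<le>Suc (degree p). (X ^^ i) (\<phi> (coeff (pCons c p) i)))"
    by (rule ext_pad) (simp_all add: assms degree_pCons_le)
  then show ?thesis
    by (simp add: sum.atMost_Suc_shift ext_def additive.sum[OF assms(1)] del: sum.atMost_Suc)
qed

section \<open>Naturality of the substitutions in the coefficients\<close>

lemma additive_map_poly: "additive g \<Longrightarrow> additive (map_poly g)"
  by (simp add: additive_def poly_eq_iff coeff_map_poly additive.zero[unfolded additive_def])

lemma additive_mul: "additive mul_lam" "additive mul_mu" "additive mul_sum"
  by (simp_all add: additive_def mul_sum_def mul_lam_def mul_mu_def poly_eq_iff coeff_map_poly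
      coeff_pCons split: nat.split)

lemma additive_mult: "additive ((*) (l::complex))"
  by (simp add: additive_def algebra_simps)

lemma additive_const: "additive (\<lambda>x::'a::ab_group_add. [:[:x:]:])"
  by (simp add: additive_def)

lemma additive_at_var: "additive X \<Longrightarrow> additive (at_var X)"
  by (simp add: at_var_def additive_ext additive_const)

lemma map_poly_mul:
  assumes "additive g"
  shows "map_poly (map_poly g) (mul_lam q) = mul_lam (map_poly (map_poly g) q)"
    and "map_poly (map_poly g) (mul_mu q) = mul_mu (map_poly (map_poly g) q)"
    and "map_poly (map_poly g) (mul_sum q) = mul_sum (map_poly (map_poly g) q)"
proof -
  have g0: "g 0 = 0" by (rule additive.zero[OF assms])
  show 1: "map_poly (map_poly g) (mul_lam q) = mul_lam (map_poly (map_poly g) q)"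
    by (simp add: mul_lam_def map_poly_pCons)
  show 2: "map_poly (map_poly g) (mul_mu q) = mul_mu (map_poly (map_poly g) q)"
    by (simp add: mul_mu_def poly_eq_iff coeff_map_poly map_poly_pCons g0)
  show "map_poly (map_poly g) (mul_sum q) = mul_sum (map_poly (map_poly g) q)"
    unfolding mul_sum_def 1[symmetric] 2[symmetric]
    by (rule additive.add) (intro additive_map_poly assms)
qed

lemma map_poly_at_var:
  assumes "additive g" "additive Y'"
    and "\<And>q. map_poly (map_poly g) (Y q) = Y' (map_poly (map_poly g) q)"
  shows "map_poly (map_poly g) (at_var Y p) = at_var Y' (map_poly g p)"
  unfolding at_var_def
  by (subst ext_intertwine[where T = "map_poly (map_poly g)" and Y = Y'])
    (simp_all add: assms additive_map_poly ext_map_poly additive.zero map_poly_pCons)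

text \<open>With \<open>g\<close> equal to \<open>fst\<close> or \<open>snd\<close>, this moves the
  projection inside each term of the left-symmetry axiom of the direct sum.\<close>

lemma map_poly_ext_at_var:
  assumes "additive g" "additive Y'"
    and "\<And>q. map_poly (map_poly g) (X q) = X' (map_poly (map_poly g) q)"
    and "\<And>q. map_poly (map_poly g) (Y q) = Y' (map_poly (map_poly g) q)"
  shows "map_poly (map_poly g) (ext X (\<lambda>x. at_var Y (\<phi> x)) p)
    = ext X' (\<lambda>x. at_var Y' (map_poly g (\<phi> x))) p"
  by (subst ext_intertwine[where T = "map_poly (map_poly g)" and Y = X'])
    (simp_all add: assms additive_map_poly map_poly_at_var[of g Y'])

lemma map_poly_map_poly_diff:
  "additive g \<Longrightarrow>
    map_poly (map_poly g) (p - q) = map_poly (map_poly g) p - map_poly (map_poly g) q"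
  by (rule additive.diff) (intro additive_map_poly)


section \<open>Evaluation of the indeterminates\<close>

text \<open>As an instance of \<open>ext\<close> with complex values it can be nested:
  \<open>peval l (peval m \<phi>)\<close> sets the outer \<lambda> to \<open>l\<close> and the inner
  \<mu> to \<open>m\<close>, and applies \<open>\<phi>\<close> to the coefficients.\<close>

definition peval :: "complex \<Rightarrow> ('a::ab_group_add \<Rightarrow> complex) \<Rightarrow> 'a poly \<Rightarrow> complex"
  where "peval l = ext ((*) l)"

lemma additive_peval: "additive \<phi> \<Longrightarrow> additive (peval l \<phi>)"
  by (simp add: peval_def additive_ext additive_mult)

lemma peval_pCons: "additive \<phi> \<Longrightarrow> peval l \<phi> (pCons c p) = \<phi> c + l * peval l \<phi> p"
  by (simp add: peval_def ext_pCons additive_mult additive.zero)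

lemma peval_poly: "\<phi> 0 = 0 \<Longrightarrow> peval l \<phi> p = poly (map_poly \<phi> p) l"
  by (induction p) (simp_all add: peval_def ext_zero ext_pCons additive_mult map_poly_pCons)

lemma peval_id: "peval l (\<lambda>x. x) p = poly p l"
  by (simp add: peval_poly map_poly_id')

lemma peval_map_poly:
  "\<phi> 0 = 0 \<Longrightarrow> g 0 = 0 \<Longrightarrow> peval l \<phi> (map_poly g p) = peval l (\<lambda>x. \<phi> (g x)) p"
  by (simp add: peval_def ext_map_poly additive_mult)

text \<open>A complex polynomial is determined by its values.\<close>

lemma peval_coeff_eq:
  assumes "\<phi> 0 = 0" "\<And>l. peval l \<phi> p = peval l \<phi> q"
  shows "\<phi> (coeff p i) = \<phi> (coeff q i)"
proof -
  have "map_poly \<phi> p = map_poly \<phi> q"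
    by (simp add: poly_eq_poly_eq_iff[symmetric] fun_eq_iff peval_poly[symmetric] assms)
  then have "coeff (map_poly \<phi> p) i = coeff (map_poly \<phi> q) i" by simp
  then show ?thesis by (simp add: coeff_map_poly assms(1))
qed

lemma peval_sum_fun:
  "peval l (\<lambda>x. \<Sum>i\<in>I. c i * \<phi> i x) p = (\<Sum>i\<in>I. c i * peval l (\<phi> i) p)"
proof -
  have pw: "((*) l ^^ i) x = l ^ i * x" for i and x :: complex
    by (induction i) (simp_all add: algebra_simps)
  have "(\<Sum>j\<le>degree p. \<Sum>i\<in>I. l ^ j * (c i * \<phi> i (coeff p j)))
      = (\<Sum>i\<in>I. \<Sum>j\<le>degree p. l ^ j * (c i * \<phi> i (coeff p j)))"
    by (rule sum.swap)
  then show ?thesis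
    by (simp add: peval_def ext_def pw sum_distrib_left mult.left_commute)
qed

lemma peval_altdef: "peval l \<phi> p = (\<Sum>i\<le>degree p. l ^ i * \<phi> (coeff p i))"
proof -
  have "((*) l ^^ i) x = l ^ i * x" for i and x :: complex
    by (induction i) (simp_all add: algebra_simps)
  then show ?thesis by (simp add: peval_def ext_def)
qed

text \<open>An interchange of finite sums, needed when the dual action is applied twice.\<close>

lemma peval_swap:
  "peval l (\<lambda>x. peval m (\<lambda>y. h x y) q) p = peval m (\<lambda>y. peval l (\<lambda>x. h x y) p) q"
  unfolding peval_altdef[of m] by (simp add: peval_sum_fun)

lemma peval_uminus_fun: "peval l (\<lambda>x. - \<phi> x) p = - peval l \<phi> p"
  by (simp add: peval_altdef sum_negf)

lemma peval_add_fun: "peval l (\<lambda>x. \<phi> x + \<psi> x) p = peval l \<phi> p + peval l \<psi> p"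
  by (simp add: peval_def ext_add_fun additive_mult)

lemma peval_cmult_fun: "peval l (\<lambda>x. c * \<phi> x) p = c * peval l \<phi> p"
  by (simp add: peval_altdef sum_distrib_left mult.left_commute)

section \<open>Evaluation turns the substitutions into scalars\<close>

lemma peval_mul:
  assumes "additive \<phi>"
  shows "peval l (peval m \<phi>) (mul_lam q) = l * peval l (peval m \<phi>) q"
    and "peval l (peval m \<phi>) (mul_mu q) = m * peval l (peval m \<phi>) q"
    and "peval l (peval m \<phi>) (mul_sum q) = (l + m) * peval l (peval m \<phi>) q"
proof -
  have z: "\<phi> 0 = 0" "peval m \<phi> 0 = 0" by (simp_all add: assms additive_peval additive.zero)
  show 1: "peval l (peval m \<phi>) (mul_lam q) = l * peval l (peval m \<phi>) q"
    by (simp add: mul_lam_def peval_pCons additive_peval assms z)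
  show 2: "peval l (peval m \<phi>) (mul_mu q) = m * peval l (peval m \<phi>) q"
    by (simp add: mul_mu_def peval_map_poly peval_pCons additive_peval assms z peval_cmult_fun)
  show "peval l (peval m \<phi>) (mul_sum q) = (l + m) * peval l (peval m \<phi>) q"
    unfolding mul_sum_def
    by (simp add: additive.add[OF additive_peval[OF additive_peval[OF assms]]] 1 2 algebra_simps)
qed

text \<open>This is \<open>ext_intertwine\<close> with the evaluation as \<open>T\<close>: if
  \<open>X\<close> evaluates to the scalar \<open>s\<close>, then substituting \<open>X\<close>
  becomes evaluating at \<open>s\<close>.\<close>

lemma peval_ext:
  assumes "additive \<phi>" "\<And>q. peval l (peval m \<phi>) (X q) = s * peval l (peval m \<phi>) q"
  shows "peval l (peval m \<phi>) (ext X \<psi> p) = peval s (\<lambda>x. peval l (peval m \<phi>) (\<psi> x)) p"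
  unfolding peval_def[of s]
  by (rule ext_intertwine) (simp_all add: assms additive_peval)

lemma peval_at_var:
  assumes "additive \<phi>" "\<And>q. peval l (peval m \<phi>) (X q) = s * peval l (peval m \<phi>) q"
  shows "peval l (peval m \<phi>) (at_var X p) = peval s \<phi> p"
proof -
  have "peval l (peval m \<phi>) 0 = 0" "peval m \<phi> 0 = 0"
    by (simp_all add: assms additive_peval additive.zero)
  then show ?thesis
    unfolding at_var_def peval_ext[OF assms]
    by (simp add: peval_pCons additive_peval assms(1))
qed

lemmas peval_ext_lam = peval_ext[OF _ peval_mul(1)]
lemmas peval_ext_mu = peval_ext[OF _ peval_mul(2)]
lemmas peval_at_lam = peval_at_var[OF _ peval_mul(1)]
lemmas peval_at_mu = peval_at_var[OF _ peval_mul(2)]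
lemmas peval_at_sum = peval_at_var[OF _ peval_mul(3)]


section \<open>The left action on the conformal dual\<close>

text \<open>The functional comes last so that \<open>dfun n d\<close> can serve as the coefficient
  map in \<open>peval\<close>.\<close>

definition dfun :: "complex \<Rightarrow> 'a::cd_module \<Rightarrow> 'a conformal_dual \<Rightarrow> complex"
  where "dfun n d f = poly (app f d) n"

lemma app_dual_simps:
  "app (f + g) d = app f d + app g d"
  "app 0 d = 0"
  "app (act p f) d = pcompose p [:0, -1:] * app f d"
  by (transfer; simp)+

text \<open>The two \<open>del\<close> rules differ in sign: the derivation acts on functionals as
  -\<lambda>, but leaves the argument of a functional as \<lambda>.\<close>

lemma dfun_simps:
  "dfun n d (f + g) = dfun n d f + dfun n d g"
  "dfun n (d + e) f = dfun n d f + dfun n e f"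
  "dfun n d (act p f) = poly p (-n) * dfun n d f"
  "dfun n (cscale c d) f = c * dfun n d f"
  "dfun n d (cscale c f) = c * dfun n d f"
  "dfun n (del d) f = n * dfun n d f"
  "dfun n d (del f) = - n * dfun n d f"
proof -
  show "dfun n d (cscale c f) = c * dfun n d f" "dfun n d (del f) = - n * dfun n d f"
    by (simp_all add: dfun_def app_dual_simps cscale_def del_def poly_pcompose)
qed (simp_all add: dfun_def app_dual_simps app_linear poly_pcompose)

lemma additive_dfun: "additive (dfun n d)" "additive (\<lambda>d. dfun n d f)"
  by (simp_all add: additive_def dfun_simps)

lemma dfun_zero: "dfun n d 0 = 0" "dfun n 0 f = 0"
  by (simp_all add: dfun_def app_dual_simps app_0)

lemma dual_eqI: "(\<And>n d. dfun n d f = dfun n d g) \<Longrightarrow> f = g"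
  by (simp add: dfun_def app_inject[symmetric] fun_eq_iff poly_eq_poly_eq_iff[symmetric])

lemma dual_poly_eqI:
  assumes "\<And>l n d. peval l (dfun n d) F = peval l (dfun n d) G"
  shows "F = G"
  by (rule poly_eqI, rule dual_eqI, rule peval_coeff_eq) (simp_all add: assms dfun_zero)

text \<open>Points are separated one variable at a time: first \<lambda>, then \<mu>, then the
  indeterminate and the argument of the functional.\<close>

lemma dual_poly_poly_eqI:
  assumes "\<And>l m n d. peval l (peval m (dfun n d)) F = peval l (peval m (dfun n d)) G"
  shows "F = G"
  by (rule poly_eqI, rule dual_poly_eqI, rule peval_coeff_eq)
    (simp_all add: assms additive.zero additive_peval additive_dfun)

lemma complex_bilinear_iff:
  "complex_bilinear h \<longleftrightarrow>
    (\<forall>x y z. h x (y + z) = h x y + h x z) \<and> (\<forall>c x y. h x (cscale c y) = cscale c (h x y)) \<and>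
    (\<forall>x y z. h (x + y) z = h x z + h y z) \<and> (\<forall>c x y. h (cscale c x) y = cscale c (h x y))"
  unfolding complex_bilinear_def Vector_Spaces.linear_iff
  by (auto simp: cd_vs.vector_space_axioms)

lemma cscale_poly: "cscale c p = map_poly (cscale c) p"
  by (simp add: cscale_def[abs_def] act_poly_def)

lemma del_poly: "del p = map_poly del p"
  by (simp add: del_def[abs_def] act_poly_def)

lemma cscale_del_zero: "cscale c 0 = 0" "del 0 = 0"
  by (simp_all add: cscale_def del_def)

lemma peval_cscale:
  "\<phi> 0 = 0 \<Longrightarrow> (\<And>x. \<phi> (cscale c x) = c * \<phi> x) \<Longrightarrow> peval l \<phi> (cscale c p) = c * peval l \<phi> p"
  by (simp add: cscale_poly peval_map_poly cscale_del_zero peval_cmult_fun)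

section \<open>Bilinearity, sesquilinearity and the module law of the dual action\<close>

context
  fixes pr :: "'a::cd_module \<Rightarrow> 'a \<Rightarrow> 'a poly"
  assumes fg: "\<exists>S::'a set. finite S \<and> module.span act S = UNIV"
    and lsca: "left_symmetric_conformal_algebra pr"
begin

lemma pr_bilinear: "complex_bilinear pr" and pr_sesquilinear: "conformal_sesquilinear pr"
  using lsca by (simp_all add: left_symmetric_conformal_algebra_def)

lemma pr_linear:
  "pr a (b + c) = pr a b + pr a c" "pr a (cscale z b) = cscale z (pr a b)"
  "pr (a + b) c = pr a c + pr b c" "pr (cscale z a) b = cscale z (pr a b)"
  using pr_bilinear by (simp_all add: complex_bilinear_iff)

lemma pr_del: "pr (del a) b = - pCons 0 (pr a b)"
  using pr_sesquilinear by (simp add: conformal_sesquilinear_def)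

text \<open>The defining relation F_{\<lambda>+\<mu>}(d) = -f_\<mu>(a_\<lambda> d) is evaluated at
  \<lambda> = l and \<mu> = n - l, so that \<lambda> + \<mu> = n.\<close>

lemma peval_dual_left:
  "peval l (dfun n d) (dual_left pr a f) = - peval l (\<lambda>x. dfun (n - l) x f) (pr a d)"
proof -
  let ?F = "dual_left pr a f" and ?T = "peval l (peval (n - l) (\<lambda>x. x))"
  have id: "additive (\<lambda>x::complex. x)" by (simp add: additive_def)
  \<comment> \<open>Finite generation enters here: it guarantees that the definite description
    denotes.\<close>
  have "is_dual_left pr a f ?F"
    unfolding dual_left_def
    by (rule theI'[OF dual_left_ex1[OF fg pr_bilinear pr_sesquilinear]])
  then have "?T (ext mul_lam (\<lambda>\<phi>. at_var mul_sum (app \<phi> d)) ?F)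
      = ?T (- ext mul_lam (\<lambda>x. at_var mul_mu (app f x)) (pr a d))"
    by (simp add: is_dual_left_def)
  then show ?thesis
    by (simp add: additive.minus[OF additive_peval[OF additive_peval[OF id]]]
        peval_ext_lam[OF id] peval_at_sum[OF id] peval_at_mu[OF id]
        id peval_id dfun_def[abs_def])
qed

lemma dual_left_bilinear: "complex_bilinear (dual_left pr)"
proof -
  note add = additive.add[OF additive_peval[OF additive_dfun(1)]]
    additive.add[OF additive_peval[OF additive_dfun(2)]]
  show ?thesis
    unfolding complex_bilinear_iff
  proof (intro conjI allI)
    fix a b :: 'a and f g and c
    show "dual_left pr a (f + g) = dual_left pr a f + dual_left pr a g"
      by (rule dual_poly_eqI)
        (simp add: add peval_dual_left dfun_simps peval_add_fun)
    show "dual_left pr a (cscale c f) = cscale c (dual_left pr a f)"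
      by (rule dual_poly_eqI)
        (simp add: peval_dual_left dfun_simps dfun_zero peval_cmult_fun peval_cscale)
    show "dual_left pr (a + b) f = dual_left pr a f + dual_left pr b f"
      by (rule dual_poly_eqI) (simp add: add peval_dual_left pr_linear)
    show "dual_left pr (cscale c a) f = cscale c (dual_left pr a f)"
      by (rule dual_poly_eqI)
        (simp add: peval_dual_left dfun_simps dfun_zero pr_linear peval_cscale)
  qed
qed

lemma dual_left_linear:
  "dual_left pr a (f + g) = dual_left pr a f + dual_left pr a g"
  "dual_left pr a (cscale z f) = cscale z (dual_left pr a f)"
  "dual_left pr (a + b) f = dual_left pr a f + dual_left pr b f"
  "dual_left pr (cscale z a) f = cscale z (dual_left pr a f)"
  using dual_left_bilinear by (simp_all add: complex_bilinear_iff)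

text \<open>In the second argument, the derivation scales the value of \<open>f\<close> at n - l by
  -(n - l) = -n + l; here -n is the derivation on the result and l is multiplication by
  \<lambda>.\<close>

lemma dual_left_sesquilinear: "conformal_sesquilinear (dual_left pr)"
proof -
  note ad = additive_peval[OF additive_dfun(1)] and ad' = additive_peval[OF additive_dfun(2)]
  show ?thesis
    unfolding conformal_sesquilinear_def
  proof (intro conjI allI)
    fix a :: 'a and f
    show "dual_left pr (del a) f = - pCons 0 (dual_left pr a f)"
      by (rule dual_poly_eqI)
        (simp add: additive.minus[OF ad] additive.minus[OF ad'] peval_dual_left pr_del
          peval_pCons additive_dfun dfun_zero)
    show "dual_left pr a (del f) = del (dual_left pr a f) + pCons 0 (dual_left pr a f)"
    proof (rule dual_poly_eqI)
      fix l n d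
      have "peval l (dfun n d) (del F) = - n * peval l (dfun n d) F" for F :: "'a conformal_dual poly"
        by (simp only: del_poly peval_map_poly dfun_zero cscale_del_zero dfun_simps peval_cmult_fun)
      then show "peval l (dfun n d) (dual_left pr a (del f))
          = peval l (dfun n d) (del (dual_left pr a f) + pCons 0 (dual_left pr a f))"
        by (simp only: additive.add[OF ad] peval_dual_left peval_pCons additive_dfun dfun_zero
            dfun_simps peval_cmult_fun) (simp add: algebra_simps)
    qed
  qed
qed

lemma dual_left_module:
  "ext mul_lam (\<lambda>x. at_var mul_sum (dual_left pr x h)) (pr a b)
      - ext mul_mu (\<lambda>f. at_var mul_lam (dual_left pr a f)) (dual_left pr b h)
    = ext mul_mu (\<lambda>x. at_var mul_sum (dual_left pr x h)) (pr b a)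
      - ext mul_lam (\<lambda>f. at_var mul_mu (dual_left pr b f)) (dual_left pr a h)"
proof (rule dual_poly_poly_eqI)
  fix l m n and d :: 'a
  \<comment> \<open>The actions of \<open>a\<close> and \<open>b\<close> lower the evaluation point
    by l and m, whichever comes first; acting with the product lowers it by l + m at once.\<close>
  let ?h = "\<lambda>x. dfun (n - l - m) x h"
  let ?T = "peval l (peval m (dfun n d))" and ?T' = "peval l (peval m ?h)"
  note ad = additive_dfun
  note diff = additive.diff[OF additive_peval[OF additive_peval[OF ad(1)]]]
    additive.diff[OF additive_peval[OF additive_peval[OF ad(2)]]]
  note simps = diff peval_ext_lam peval_ext_mu peval_at_lam peval_at_mu peval_at_sum ad
  have comm: "n - (l + m) = n - l - m" "n - m - l = n - l - m" by simp_all
  \<comment> \<open>Left-symmetry of \<open>A\<close> for \<open>a\<close>, \<open>b\<close>,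
    \<open>d\<close>, with the functional \<open>h\<close> applied to the coefficients.\<close>
  have eq: "?T' (ext mul_lam (\<lambda>x. at_var mul_sum (pr x d)) (pr a b)
        - ext mul_mu (\<lambda>x. at_var mul_lam (pr a x)) (pr b d))
      = ?T' (ext mul_mu (\<lambda>x. at_var mul_sum (pr x d)) (pr b a)
        - ext mul_lam (\<lambda>x. at_var mul_mu (pr b x)) (pr a d))"
    using lsca by (simp add: left_symmetric_conformal_algebra_def)
  \<comment> \<open>Acting twice cancels the two signs and reverses the order: \<open>b\<close> now
    multiplies the result of \<open>a\<close> on \<open>d\<close>. Hence the nested terms change
    sides compared with \<open>eq\<close>.\<close>
  have nested: "peval m (\<lambda>f. peval l (dfun n d) (dual_left pr a f)) (dual_left pr b h)
      = peval l (\<lambda>x. peval m (\<lambda>y. dfun (n - l - m) y h) (pr b x)) (pr a d)" for l m a b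
  proof -
    have "peval m (\<lambda>f. peval l (dfun n d) (dual_left pr a f)) (dual_left pr b h)
        = - peval m (\<lambda>f. peval l (\<lambda>x. dfun (n - l) x f) (pr a d)) (dual_left pr b h)"
      by (simp add: peval_dual_left peval_uminus_fun)
    also have "\<dots> = - peval l (\<lambda>x. peval m (dfun (n - l) x) (dual_left pr b h)) (pr a d)"
      by (subst peval_swap) simp
    finally show ?thesis
      by (simp add: peval_dual_left peval_uminus_fun)
  qed
  show "?T (ext mul_lam (\<lambda>x. at_var mul_sum (dual_left pr x h)) (pr a b)
        - ext mul_mu (\<lambda>f. at_var mul_lam (dual_left pr a f)) (dual_left pr b h))
      = ?T (ext mul_mu (\<lambda>x. at_var mul_sum (dual_left pr x h)) (pr b a)
        - ext mul_lam (\<lambda>f. at_var mul_mu (dual_left pr b f)) (dual_left pr a h))"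
    using eq
    by (simp add: simps nested, simp add: peval_dual_left peval_uminus_fun comm,
        simp add: algebra_simps)
qed

end


section \<open>The twisted product\<close>

lemma additive_fst_snd: "additive fst" "additive snd"
  by (simp_all add: additive_def)

lemma prod_poly_eq_iff: "p = q \<longleftrightarrow> map_poly fst p = map_poly fst q \<and> map_poly snd p = map_poly snd q"
  by (auto simp: poly_eq_iff coeff_map_poly prod_eq_iff)

lemma prod_poly_poly_eq_iff:
  "p = q \<longleftrightarrow> map_poly (map_poly fst) p = map_poly (map_poly fst) q \<and>
    map_poly (map_poly snd) p = map_poly (map_poly snd) q"
  by (auto simp: poly_eq_iff[of p] poly_eq_iff[of "map_poly (map_poly _) p"] coeff_map_poly
      prod_poly_eq_iff)

lemma map_poly_act:
  "map_poly fst (act p P) = act p (map_poly fst P)"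
  "map_poly snd (act p P) = act p (map_poly snd P)"
  by (simp_all add: poly_eq_iff coeff_map_poly act_poly_def act_prod_def zero_prod_def)

lemma map_poly_prod:
  "map_poly fst (P + Q) = map_poly fst P + map_poly fst Q"
  "map_poly snd (P + Q) = map_poly snd P + map_poly snd Q"
  "map_poly fst (- P) = - map_poly fst P"
  "map_poly snd (- P) = - map_poly snd P"
  "map_poly fst (pCons 0 P) = pCons 0 (map_poly fst P)"
  "map_poly snd (pCons 0 P) = pCons 0 (map_poly snd P)"
  "map_poly fst (cscale c P) = cscale c (map_poly fst P)"
  "map_poly snd (cscale c P) = cscale c (map_poly snd P)"
  "map_poly fst (del P) = del (map_poly fst P)"
  "map_poly snd (del P) = del (map_poly snd P)"
  by (simp_all add: poly_eq_iff coeff_map_poly coeff_pCons cscale_def del_def map_poly_act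
      split: nat.split)

lemma fst_snd_act:
  "fst (cscale c x) = cscale c (fst x)" "snd (cscale c x) = cscale c (snd x)"
  "fst (del x) = del (fst x)" "snd (del x) = del (snd x)"
  by (simp_all add: cscale_def del_def act_prod_def)

lemma map_poly_twisted_product:
  "map_poly fst (twisted_product pr \<omega> x y) = pr (fst x) (fst y)"
  "map_poly snd (twisted_product pr \<omega> x y) = \<omega> (fst x) (fst y) + dual_left pr (fst x) (snd y)"
  by (simp_all add: twisted_product_def split_beta poly_eq_iff coeff_map_poly zero_prod_def)

section \<open>The algebra axioms for the product on the direct sum\<close>

context
  fixes pr :: "'a::cd_module \<Rightarrow> 'a \<Rightarrow> 'a poly"
    and \<omega> :: "'a \<Rightarrow> 'a \<Rightarrow> 'a conformal_dual poly"
  assumes fg: "\<exists>S::'a set. finite S \<and> module.span act S = UNIV"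
    and lsca: "left_symmetric_conformal_algebra pr"
    and bil: "complex_bilinear \<omega>"
begin

private lemma cochain_linear:
  "\<omega> a (b + c) = \<omega> a b + \<omega> a c" "\<omega> a (cscale z b) = cscale z (\<omega> a b)"
  "\<omega> (a + b) c = \<omega> a c + \<omega> b c" "\<omega> (cscale z a) b = cscale z (\<omega> a b)"
  using bil by (simp_all add: complex_bilinear_iff)

private lemmas lin = cochain_linear pr_linear[OF fg lsca] dual_left_linear[OF fg lsca]

private lemma zero:
  "\<omega> a 0 = 0" "\<omega> 0 a = 0" "dual_left pr a 0 = 0" "dual_left pr 0 f = 0"
  "pr a 0 = 0" "pr 0 a = 0"
  using lin(1)[of a 0 0] lin(3)[of 0 0 a] dual_left_linear(1)[OF fg lsca, of a 0 0]
    dual_left_linear(3)[OF fg lsca, of 0 0 f] pr_linear(1)[OF fg lsca, of a 0 0]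
    pr_linear(3)[OF fg lsca, of 0 0 a]
  by simp_all

lemma twisted_product_bilinear: "complex_bilinear (twisted_product pr \<omega>)"
  unfolding complex_bilinear_iff prod_poly_eq_iff
  by (simp add: map_poly_prod map_poly_twisted_product fst_snd_act lin cd_vs.scale_right_distrib)

text \<open>The dual action contributes its own sesquilinearity to the second component; cancelling
  it leaves the condition on \<open>\<omega>\<close>.\<close>

lemma twisted_product_sesquilinear_iff:
  "conformal_sesquilinear (twisted_product pr \<omega>) \<longleftrightarrow> conformal_sesquilinear \<omega>"
proof -
  have del_add: "del (x + y) = del x + del y" for x y :: "'a conformal_dual poly"
    by (simp add: del_def act_add_right)
  have pr: "pr (del a) b = - pCons 0 (pr a b)" "pr a (del b) = del (pr a b) + pCons 0 (pr a b)"
    for a b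
    using pr_sesquilinear[OF fg lsca] by (simp_all add: conformal_sesquilinear_def)
  have D: "dual_left pr (del a) f = - pCons 0 (dual_left pr a f)"
    "dual_left pr a (del f) = del (dual_left pr a f) + pCons 0 (dual_left pr a f)" for a f
    using dual_left_sesquilinear[OF fg lsca] by (simp_all add: conformal_sesquilinear_def)
  \<comment> \<open>Splits the multiples of \<lambda> so that summands cancel; the rules that would
    merge them again are switched off below.\<close>
  have pCons_add: "pCons 0 (p + q) = pCons 0 p + pCons 0 q" for p q :: "'a conformal_dual poly"
    by simp
  show ?thesis
    unfolding conformal_sesquilinear_def prod_poly_eq_iff
    by (simp add: map_poly_prod map_poly_twisted_product fst_snd_act pr D del_add pCons_add
        algebra_simps del: add_pCons minus_pCons diff_pCons)
qed

lemma twisted_product_left_symmetric_iff: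
  "(\<forall>x y z.
      ext mul_lam (\<lambda>u. at_var mul_sum (twisted_product pr \<omega> u z)) (twisted_product pr \<omega> x y)
        - ext mul_mu (\<lambda>u. at_var mul_lam (twisted_product pr \<omega> x u)) (twisted_product pr \<omega> y z)
      = ext mul_mu (\<lambda>u. at_var mul_sum (twisted_product pr \<omega> u z)) (twisted_product pr \<omega> y x)
        - ext mul_lam (\<lambda>u. at_var mul_mu (twisted_product pr \<omega> y u)) (twisted_product pr \<omega> x z))
    \<longleftrightarrow> (\<forall>a b c.
      ext mul_mu (\<lambda>f. at_var mul_lam (dual_left pr a f)) (\<omega> b c)
      - ext mul_lam (\<lambda>f. at_var mul_mu (dual_left pr b f)) (\<omega> a c)
      - ext mul_lam (\<lambda>x. at_var mul_mu (\<omega> b x)) (pr a c)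
      + ext mul_mu (\<lambda>x. at_var mul_lam (\<omega> a x)) (pr b c)
      - ext mul_lam (\<lambda>x. at_var mul_sum (\<omega> x c)) (pr a b)
      + ext mul_mu (\<lambda>x. at_var mul_sum (\<omega> x c)) (pr b a) = 0)"
    (is "(\<forall>x y z. ?L x y z = ?R x y z) \<longleftrightarrow> (\<forall>a b c. ?C a b c = 0)")
proof -
  note proj = map_poly_ext_at_var[where X = mul_mu and X' = mul_mu and Y = mul_lam and Y' = mul_lam,
      OF _ additive_mul(1) map_poly_mul(2) map_poly_mul(1)]
    map_poly_ext_at_var[where X = mul_lam and X' = mul_lam and Y = mul_mu and Y' = mul_mu,
      OF _ additive_mul(2) map_poly_mul(1) map_poly_mul(2)]
    map_poly_ext_at_var[where X = mul_lam and X' = mul_lam and Y = mul_sum and Y' = mul_sum,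
      OF _ additive_mul(3) map_poly_mul(1) map_poly_mul(3)]
    map_poly_ext_at_var[where X = mul_mu and X' = mul_mu and Y = mul_sum and Y' = mul_sum,
      OF _ additive_mul(3) map_poly_mul(2) map_poly_mul(3)]
  have at_zero: "at_var X 0 = 0" if "additive X" for X :: "'m::ab_group_add poly poly \<Rightarrow> _"
    using that by (simp add: additive.zero additive_at_var)
  have at_add: "at_var X (p + q) = at_var X p + at_var X q" if "additive X"
    for X :: "'m::ab_group_add poly poly \<Rightarrow> _" and p q
    using that by (simp add: additive.add additive_at_var)
  \<comment> \<open>The \<open>A\<close>-component of a product is its image under
    \<open>fst\<close>, so both sides sum over the same coefficients.\<close>
  have fst_ext: "ext X \<psi> (pr (fst x) (fst y)) = ext X (\<lambda>u. \<psi> (fst u)) (twisted_product pr \<omega> x y)"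
    if "additive X" "\<psi> 0 = 0" for X :: "'m::ab_group_add \<Rightarrow> 'm" and \<psi> x y
    using ext_map_poly[where X = X and \<phi> = \<psi> and g = fst and p = "twisted_product pr \<omega> x y", OF that]
    by (simp add: map_poly_twisted_product)
  \<comment> \<open>Here \<open>\<psi>\<close> must be additive, because the second component of a
    product is a sum.\<close>
  have snd_ext: "ext X \<psi> (\<omega> (fst x) (fst y)) + ext X \<psi> (dual_left pr (fst x) (snd y))
      = ext X (\<lambda>u. \<psi> (snd u)) (twisted_product pr \<omega> x y)"
    if "additive X" "additive \<psi>" for X :: "'m::ab_group_add \<Rightarrow> 'm" and \<psi> x y
    using ext_map_poly[where X = X and \<phi> = \<psi> and g = snd and p = "twisted_product pr \<omega> x y",
        OF that(1) additive.zero[OF that(2)]] ext_add[OF that]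
    by (simp add: map_poly_twisted_product)
  have fst_fst: "ext X (\<lambda>u. at_var Y (pr (fst u) c)) (twisted_product pr \<omega> x y)
      = ext X (\<lambda>u. at_var Y (pr u c)) (pr (fst x) (fst y))"
    and fst_fst': "ext X (\<lambda>u. at_var Y (pr c (fst u))) (twisted_product pr \<omega> x y)
      = ext X (\<lambda>u. at_var Y (pr c u)) (pr (fst x) (fst y))"
    if "additive X" "additive Y" for X Y x y c
    by (simp_all add: fst_ext zero at_zero that)
  have snd_fst: "ext X (\<lambda>u. at_var Y (\<omega> (fst u) c + dual_left pr (fst u) h)) (twisted_product pr \<omega> x y)
      = ext X (\<lambda>u. at_var Y (\<omega> u c)) (pr (fst x) (fst y))
        + ext X (\<lambda>u. at_var Y (dual_left pr u h)) (pr (fst x) (fst y))"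
    if "additive X" "additive Y" for X Y x y c h
    by (simp add: fst_ext zero at_zero at_add ext_add_fun that)
  \<comment> \<open>Left multiplication by \<open>a\<close> of a product yields three terms:
    \<open>\<omega>\<close> on the \<open>A\<close>-component, and the dual action on each summand
    of the other component.\<close>
  have snd_snd: "ext X (\<lambda>u. at_var Y (\<omega> a (fst u) + dual_left pr a (snd u))) (twisted_product pr \<omega> x y)
      = ext X (\<lambda>u. at_var Y (\<omega> a u)) (pr (fst x) (fst y))
        + ext X (\<lambda>f. at_var Y (dual_left pr a f)) (\<omega> (fst x) (fst y))
        + ext X (\<lambda>f. at_var Y (dual_left pr a f)) (dual_left pr (fst x) (snd y))"
    if "additive X" "additive Y" for X Y x y a
  proof -
    have "additive (\<lambda>f. at_var Y (dual_left pr a f))"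
      unfolding additive_def by (simp add: lin at_add that)
    then show ?thesis
      by (simp add: fst_ext snd_ext zero at_zero at_add ext_add_fun that add.assoc)
  qed
  have fst_eq: "map_poly (map_poly fst) (?L x y z) = map_poly (map_poly fst) (?R x y z)" for x y z
  proof -
    have "ext mul_lam (\<lambda>u. at_var mul_sum (pr u (fst z))) (pr (fst x) (fst y))
        - ext mul_mu (\<lambda>u. at_var mul_lam (pr (fst x) u)) (pr (fst y) (fst z))
      = ext mul_mu (\<lambda>u. at_var mul_sum (pr u (fst z))) (pr (fst y) (fst x))
        - ext mul_lam (\<lambda>u. at_var mul_mu (pr (fst y) u)) (pr (fst x) (fst z))"
      using lsca by (simp add: left_symmetric_conformal_algebra_def)
    then show ?thesis
      by (simp add: map_poly_map_poly_diff additive_fst_snd proj map_poly_twisted_product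
          fst_fst fst_fst' additive_mul)
  qed
  \<comment> \<open>All terms containing \<open>snd z\<close> cancel by
    \<open>dual_left_module\<close>; the right side minus the left side is then the cocycle
    expression.\<close>
  have snd_eq: "map_poly (map_poly snd) (?L x y z) = map_poly (map_poly snd) (?R x y z)
      \<longleftrightarrow> ?C (fst x) (fst y) (fst z) = 0" for x y z
    using dual_left_module[OF fg lsca, of "snd z" "fst x" "fst y"]
    by (simp add: map_poly_map_poly_diff additive_fst_snd proj map_poly_twisted_product
        snd_fst snd_snd additive_mul) (auto simp: algebra_simps)
  show ?thesis
    \<comment> \<open>Every triple in \<open>A\<close> arises as first components of a triple of
      pairs, so the two quantifications agree.\<close>
    unfolding prod_poly_poly_eq_iff[where p = "?L _ _ _"] fst_eq snd_eq by force
qed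

end

theorem proposition6p4:
  fixes pr :: "'a::cd_module \<Rightarrow> 'a \<Rightarrow> 'a poly"
    and \<omega> :: "'a \<Rightarrow> 'a \<Rightarrow> 'a conformal_dual poly"
  assumes "\<exists>S::'a set. finite S \<and> module.span act S = UNIV"
    and "left_symmetric_conformal_algebra pr"
    and "complex_bilinear \<omega>"
  shows "left_symmetric_conformal_algebra (twisted_product pr \<omega>) \<longleftrightarrow> two_cocycle pr \<omega>"
  unfolding left_symmetric_conformal_algebra_def[of "twisted_product pr \<omega>"]
    two_cocycle_def two_cochain_def
    twisted_product_sesquilinear_iff[OF assms] twisted_product_left_symmetric_iff[OF assms]
  using twisted_product_bilinear[OF assms] assms(3) by blast

end
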